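(* Let $B$ be a finite subset of $\mathrm{M}$. Then $\mathrm{SAT}(\{\mathsf{F},\mathsf{G},\mathsf{X},\mathsf{U},\mathsf{S}\},B)$ can be decided in polynomial time.
   Context: A Boolean function is a map $f:\{0,1\}^n\to\{0,1\}$; each is used as an $n$-ary propositional connective. $\mathrm{M}$ is the set of monotone Boolean functions ($a_1\le b_1,\dots,a_n\le b_n$ implies $f(a_1,\dots,a_n)\le f(b_1,\dots,b_n)$). A temporal $B$-formula over a set $M$ of temporal operators is built from propositional variables using connectives from $B$ and operators from $M$. A structure $S=(s,V,\xi)$ is an infinite sequence $(s_i)_{i\in\mathbb N}$ of distinct states, a variable set $V$, and $\xi$ assigning to each state the set of variables true there. Semantics: $S,s_i\models x$ iff $x\in\xi(s_i)$; Boolean connectives pointwise; $S,s_i\models\mathsf{X}\varphi$ iff $S,s_{i+1}\models\varphi$; $S,s_i\models\varphi_1\mathsf{U}\varphi_2$ iff some $k\ge i$ has $S,s_k\models\varphi_2$ and $S,s_j\models\varphi_1$ for all $i\le j<k$; $S,s_i\models\varphi_1\mathsf{S}\varphi_2$ iff some $k\le i$ has $S,s_k\models\varphi_2$ and $S,s_j\models\varphi_1$ for all $k<j\le i$; $\mathsf{F}\varphi=\mathrm{true}\,\mathsf{U}\,\varphi$, $\mathsf{G}\varphi=\neg\mathsf{F}\neg\varphi$. A formula is satisfiable if it holds at some state of some structure. $\mathrm{SAT}(M,B)$ is the problem of deciding satisfiability of temporal $B$-formulae over $M$. *)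

theory Defs
  imports Main "HOL-Library.FuncSet" "HOL-Computational_Algebra.Polynomial"
begin

section \<open>Boolean functions\<close>

text \<open>A Boolean function is its arity \<open>n\<close> together with a map on bit lists of length \<open>n\<close>.
  Extensionality makes two Boolean functions equal as soon as they agree on all arguments.\<close>

type_synonym boolfun = "nat \<times> (bool list \<Rightarrow> bool)"

definition boolfuns :: "boolfun set" where
  "boolfuns = (SIGMA n:UNIV. {a. length a = n} \<rightarrow>\<^sub>E UNIV)"

definition monotone_boolfuns :: "boolfun set" where
  "monotone_boolfuns =
     {(n, f) \<in> boolfuns. \<forall>a b. length a = n \<and> length b = n \<and> (\<forall>i<n. a ! i \<le> b ! i) \<longrightarrow> f a \<le> f b}"

section \<open>Temporal formulae\<close>

datatype temporal_op = OpF | OpG | OpX | OpU | OpS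

datatype formula =
    Var nat
  | Conn boolfun "formula list"
  | Future formula
  | Globally formula
  | Next formula
  | Until formula formula
  | Since formula formula

inductive_set temporal_formulas :: "temporal_op set \<Rightarrow> boolfun set \<Rightarrow> formula set"
  for M :: "temporal_op set" and B :: "boolfun set" where
  "Var x \<in> temporal_formulas M B"
| "f \<in> B \<Longrightarrow> length \<phi>s = fst f \<Longrightarrow> \<forall>\<phi> \<in> set \<phi>s. \<phi> \<in> temporal_formulas M B
     \<Longrightarrow> Conn f \<phi>s \<in> temporal_formulas M B"
| "OpF \<in> M \<Longrightarrow> \<phi> \<in> temporal_formulas M B \<Longrightarrow> Future \<phi> \<in> temporal_formulas M B"
| "OpG \<in> M \<Longrightarrow> \<phi> \<in> temporal_formulas M B \<Longrightarrow> Globally \<phi> \<in> temporal_formulas M B"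
| "OpX \<in> M \<Longrightarrow> \<phi> \<in> temporal_formulas M B \<Longrightarrow> Next \<phi> \<in> temporal_formulas M B"
| "OpU \<in> M \<Longrightarrow> \<phi> \<in> temporal_formulas M B \<Longrightarrow> \<psi> \<in> temporal_formulas M B
     \<Longrightarrow> Until \<phi> \<psi> \<in> temporal_formulas M B"
| "OpS \<in> M \<Longrightarrow> \<phi> \<in> temporal_formulas M B \<Longrightarrow> \<psi> \<in> temporal_formulas M B
     \<Longrightarrow> Since \<phi> \<psi> \<in> temporal_formulas M B"

section \<open>Structures and satisfiability\<close>

record 's temporal_structure =
  state_at :: "nat \<Rightarrow> 's"
  variables :: "nat set"
  valuation :: "'s \<Rightarrow> nat set"

definition is_structure :: "'s temporal_structure \<Rightarrow> bool" where
  "is_structure S \<longleftrightarrow> inj (state_at S) \<and> (\<forall>i. valuation S (state_at S i) \<subseteq> variables S)"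

definition until :: "(nat \<Rightarrow> bool) \<Rightarrow> (nat \<Rightarrow> bool) \<Rightarrow> nat \<Rightarrow> bool" where
  "until P Q i \<longleftrightarrow> (\<exists>k\<ge>i. Q k \<and> (\<forall>j. i \<le> j \<and> j < k \<longrightarrow> P j))"

definition since :: "(nat \<Rightarrow> bool) \<Rightarrow> (nat \<Rightarrow> bool) \<Rightarrow> nat \<Rightarrow> bool" where
  "since P Q i \<longleftrightarrow> (\<exists>k\<le>i. Q k \<and> (\<forall>j. k < j \<and> j \<le> i \<longrightarrow> P j))"

text \<open>\<open>holds S i \<phi>\<close> is truth of \<open>\<phi>\<close> at the state \<open>state_at S i\<close>. The clauses for
  \<open>Future\<close> and \<open>Globally\<close> are those of \<open>true U \<phi>\<close> and \<open>\<not> F \<not> \<phi>\<close>; they are primitive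
  formulae here because \<open>true\<close> and \<open>\<not>\<close> need not be connectives of the formula.\<close>

fun holds :: "'s temporal_structure \<Rightarrow> nat \<Rightarrow> formula \<Rightarrow> bool" where
  "holds S i (Var x) \<longleftrightarrow> x \<in> valuation S (state_at S i)"
| "holds S i (Conn f \<phi>s) \<longleftrightarrow> snd f (map (holds S i) \<phi>s)"
| "holds S i (Future \<phi>) \<longleftrightarrow> until (\<lambda>_. True) (\<lambda>k. holds S k \<phi>) i"
| "holds S i (Globally \<phi>) \<longleftrightarrow> \<not> until (\<lambda>_. True) (\<lambda>k. \<not> holds S k \<phi>) i"
| "holds S i (Next \<phi>) \<longleftrightarrow> holds S (i + 1) \<phi>"
| "holds S i (Until \<phi> \<psi>) \<longleftrightarrow> until (\<lambda>j. holds S j \<phi>) (\<lambda>k. holds S k \<psi>) i"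
| "holds S i (Since \<phi> \<psi>) \<longleftrightarrow> since (\<lambda>j. holds S j \<phi>) (\<lambda>k. holds S k \<psi>) i"

text \<open>A structure has countably many states, so states may be taken to be natural numbers.\<close>

definition satisfiable :: "formula \<Rightarrow> bool" where
  "satisfiable \<phi> \<longleftrightarrow> (\<exists>(S :: nat temporal_structure) i. is_structure S \<and> holds S i \<phi>)"

section \<open>Formulae as words over a finite alphabet\<close>

text \<open>Formulae are written in prefix notation. Each connective and each temporal operator is one
  letter; the variable with index \<open>n\<close> is the letter \<open>SVar\<close> followed by \<open>n\<close> in binary, most
  significant bit first, without leading zeros.\<close>

datatype symbol = SVar | SBit bool | SConn boolfun | STemp temporal_op

fun binary :: "nat \<Rightarrow> bool list" where
  "binary n = (if n < 2 then [n = 1] else binary (n div 2) @ [odd n])"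

declare binary.simps [simp del]

fun encode :: "formula \<Rightarrow> symbol list" where
  "encode (Var n) = SVar # map SBit (binary n)"
| "encode (Conn f \<phi>s) = SConn f # concat (map encode \<phi>s)"
| "encode (Future \<phi>) = STemp OpF # encode \<phi>"
| "encode (Globally \<phi>) = STemp OpG # encode \<phi>"
| "encode (Next \<phi>) = STemp OpX # encode \<phi>"
| "encode (Until \<phi> \<psi>) = STemp OpU # encode \<phi> @ encode \<psi>"
| "encode (Since \<phi> \<psi>) = STemp OpS # encode \<phi> @ encode \<psi>"

definition alphabet :: "temporal_op set \<Rightarrow> boolfun set \<Rightarrow> symbol set" where
  "alphabet M B = {SVar} \<union> range SBit \<union> SConn ` B \<union> STemp ` M"

definition SAT :: "temporal_op set \<Rightarrow> boolfun set \<Rightarrow> symbol list set" where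
  "SAT M B = {encode \<phi> | \<phi>. \<phi> \<in> temporal_formulas M B \<and> satisfiable \<phi>}"

lemma binary_inject: "binary m = binary n \<Longrightarrow> m = n"
proof (induction m arbitrary: n rule: less_induct)
  case (less m)
  have ne: "binary k \<noteq> []" for k
    by (subst binary.simps) simp
  show ?case
  proof (cases "m < 2 \<or> n < 2")
    case True
    then show ?thesis
      using less.prems ne ne[symmetric]
      by (auto simp: binary.simps[of m] binary.simps[of n] split: if_splits)
  next
    case False
    then have eq: "binary (m div 2) @ [odd m] = binary (n div 2) @ [odd n]"
      using less.prems by (simp add: binary.simps[of m] binary.simps[of n])
    then have "m div 2 = n div 2"
      using False less.IH[of "m div 2" "n div 2"] by simp
    moreover have "odd m \<longleftrightarrow> odd n" using eq by simp
    ultimately show ?thesis by presburger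
  qed
qed

definition bit_free_start :: "symbol list \<Rightarrow> bool" where
  "bit_free_start r \<longleftrightarrow> (\<forall>b s. r \<noteq> SBit b # s)"

lemma bits_append_inject:
  "map SBit u @ r = map SBit v @ s \<Longrightarrow> bit_free_start r \<Longrightarrow> bit_free_start s \<Longrightarrow> u = v \<and> r = s"
proof (induction u arbitrary: v)
  case Nil
  then show ?case by (cases v) (auto simp: bit_free_start_def)
next
  case (Cons a u)
  from Cons.prems obtain v' where v: "v = a # v'" and eq: "map SBit u @ r = map SBit v' @ s"
    by (cases v) (auto simp: bit_free_start_def)
  show ?case using Cons.IH[OF eq Cons.prems(2,3)] v by simp
qed

lemma bit_free_start_encode: "bit_free_start (encode \<phi> @ r)"
  by (cases \<phi>) (auto simp: bit_free_start_def)

lemma bit_free_start_encode_list: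
  "bit_free_start r \<Longrightarrow> bit_free_start (concat (map encode \<phi>s) @ r)"
  by (cases \<phi>s) (auto simp: bit_free_start_encode)

inductive_simps temporal_formulas_simps:
  "Conn f \<phi>s \<in> temporal_formulas M B"
  "Future \<phi> \<in> temporal_formulas M B"
  "Globally \<phi> \<in> temporal_formulas M B"
  "Next \<phi> \<in> temporal_formulas M B"
  "Until \<phi> \<psi> \<in> temporal_formulas M B"
  "Since \<phi> \<psi> \<in> temporal_formulas M B"

lemma encode_append_inject:
  assumes "\<phi> \<in> temporal_formulas M B" "\<psi> \<in> temporal_formulas M B"
    and "encode \<phi> @ r = encode \<psi> @ s" "bit_free_start r" "bit_free_start s"
  shows "\<phi> = \<psi> \<and> r = s"
  using assms
proof (induction \<phi> arbitrary: \<psi> r s rule: temporal_formulas.induct)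
  case (1 x)
  then show ?case
    by (cases \<psi>) (auto dest: bits_append_inject binary_inject)
next
  case (2 f \<phi>s)
  from "2.prems" obtain \<psi>s where \<psi>: "\<psi> = Conn f \<psi>s"
    and eq: "concat (map encode \<phi>s) @ r = concat (map encode \<psi>s) @ s"
    by (cases \<psi>) auto
  from "2.prems"(1) \<psi> have \<psi>s: "length \<psi>s = fst f" "\<forall>\<psi> \<in> set \<psi>s. \<psi> \<in> temporal_formulas M B"
    by (simp_all add: temporal_formulas_simps)
  have "length \<phi>s = length \<psi>s" using \<psi>s "2.hyps" by simp
  then have "\<phi>s = \<psi>s \<and> r = s"
    using "2.IH" \<psi>s(2) eq
  proof (induction \<phi>s \<psi>s rule: list_induct2)
    case Nil
    then show ?case by simp
  next
    case (Cons a as b bs)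
    have "a = b \<and> concat (map encode as) @ r = concat (map encode bs) @ s"
    proof -
      have IH: "\<psi> \<in> temporal_formulas M B \<Longrightarrow> encode a @ r = encode \<psi> @ s \<Longrightarrow>
          bit_free_start r \<Longrightarrow> bit_free_start s \<Longrightarrow> a = \<psi> \<and> r = s" for \<psi> r s
        using bspec[OF Cons.prems(1) list.set_intros(1)] by blast
      have "b \<in> temporal_formulas M B" using Cons.prems(2) by simp
      moreover have "encode a @ concat (map encode as) @ r = encode b @ concat (map encode bs) @ s"
        using Cons.prems(3) by simp
      ultimately show ?thesis
        using "2.prems"(3,4) by (intro IH bit_free_start_encode_list)
    qed
    moreover have "as = bs \<and> r = s"
    proof (rule Cons.IH)
      show "concat (map encode as) @ r = concat (map encode bs) @ s" using calculation by (rule conjunct2)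
    qed (rule ballI, rule Cons.prems(1,2)[THEN bspec], erule list.set_intros(2))+
    ultimately show ?case by blast
  qed
  then show ?case using \<psi> by simp
next
  case (3 \<phi>)
  from "3.prems" obtain \<phi>' where \<psi>: "\<psi> = Future \<phi>'" and eq: "encode \<phi> @ r = encode \<phi>' @ s"
    by (cases \<psi>) auto
  from "3.prems"(1) \<psi> have "\<phi>' \<in> temporal_formulas M B"
    by (simp add: temporal_formulas_simps)
  then show ?case
    using "3.IH"[OF _ eq] "3.prems"(3,4) \<psi> by blast
next
  case (4 \<phi>)
  from "4.prems" obtain \<phi>' where \<psi>: "\<psi> = Globally \<phi>'" and eq: "encode \<phi> @ r = encode \<phi>' @ s"
    by (cases \<psi>) auto
  from "4.prems"(1) \<psi> have "\<phi>' \<in> temporal_formulas M B"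
    by (simp add: temporal_formulas_simps)
  then show ?case
    using "4.IH"[OF _ eq] "4.prems"(3,4) \<psi> by blast
next
  case (5 \<phi>)
  from "5.prems" obtain \<phi>' where \<psi>: "\<psi> = Next \<phi>'" and eq: "encode \<phi> @ r = encode \<phi>' @ s"
    by (cases \<psi>) auto
  from "5.prems"(1) \<psi> have "\<phi>' \<in> temporal_formulas M B"
    by (simp add: temporal_formulas_simps)
  then show ?case
    using "5.IH"[OF _ eq] "5.prems"(3,4) \<psi> by blast
next
  case (6 \<phi> \<chi>)
  from "6.prems" obtain \<phi>' \<chi>' where \<psi>: "\<psi> = Until \<phi>' \<chi>'"
    and eq: "encode \<phi> @ encode \<chi> @ r = encode \<phi>' @ encode \<chi>' @ s"
    by (cases \<psi>) auto
  from "6.prems"(1) \<psi> have "\<phi>' \<in> temporal_formulas M B" "\<chi>' \<in> temporal_formulas M B"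
    by (simp_all add: temporal_formulas_simps)
  then show ?case
    using "6.IH"(1)[OF _ eq] "6.IH"(2)[of \<chi>' r s] "6.prems"(3,4) \<psi> bit_free_start_encode by blast
next
  case (7 \<phi> \<chi>)
  from "7.prems" obtain \<phi>' \<chi>' where \<psi>: "\<psi> = Since \<phi>' \<chi>'"
    and eq: "encode \<phi> @ encode \<chi> @ r = encode \<phi>' @ encode \<chi>' @ s"
    by (cases \<psi>) auto
  from "7.prems"(1) \<psi> have "\<phi>' \<in> temporal_formulas M B" "\<chi>' \<in> temporal_formulas M B"
    by (simp_all add: temporal_formulas_simps)
  then show ?case
    using "7.IH"(1)[OF _ eq] "7.IH"(2)[of \<chi>' r s] "7.prems"(3,4) \<psi> bit_free_start_encode by blast
qed

lemma inj_on_encode: "inj_on encode (temporal_formulas M B)"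
proof (rule inj_onI)
  fix \<phi> \<psi>
  assume "\<phi> \<in> temporal_formulas M B" "\<psi> \<in> temporal_formulas M B" "encode \<phi> = encode \<psi>"
  then show "\<phi> = \<psi>"
    using encode_append_inject[of \<phi> M B \<psi> "[]" "[]"] by (simp add: bit_free_start_def)
qed

section \<open>Polynomial time\<close>

text \<open>Deterministic Turing machines with a fixed number of two-way infinite tapes. States are
  natural numbers; a tape cell holds the blank, an input letter or an auxiliary letter.
  A tape is given by its contents and its head position.\<close>

datatype 'a cell = Blank | Inp 'a | Aux nat

datatype direction = MoveLeft | Stay | MoveRight

record 'a machine =
  tapes :: nat
  states :: "nat set"
  tape_alphabet :: "'a cell set"
  start :: nat
  accept :: nat
  reject :: nat
  trans :: "nat \<Rightarrow> 'a cell list \<Rightarrow> nat \<times> ('a cell \<times> direction) list"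

definition is_machine :: "'a set \<Rightarrow> 'a machine \<Rightarrow> bool" where
  "is_machine \<Sigma> T \<longleftrightarrow>
     tapes T \<ge> 1 \<and>
     finite (states T) \<and> {start T, accept T, reject T} \<subseteq> states T \<and> accept T \<noteq> reject T \<and>
     finite (tape_alphabet T) \<and> insert Blank (Inp ` \<Sigma>) \<subseteq> tape_alphabet T \<and>
     (\<forall>q \<in> states T. \<forall>cs \<in> lists (tape_alphabet T). length cs = tapes T \<longrightarrow>
        fst (trans T q cs) \<in> states T \<and>
        length (snd (trans T q cs)) = tapes T \<and>
        snd (trans T q cs) \<in> lists (tape_alphabet T \<times> UNIV))"

type_synonym 'a tape = "(int \<Rightarrow> 'a cell) \<times> int"

type_synonym 'a configuration = "nat \<times> 'a tape list"

fun shift :: "direction \<Rightarrow> int" where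
  "shift MoveLeft = -1"
| "shift Stay = 0"
| "shift MoveRight = 1"

fun scan :: "'a tape \<Rightarrow> 'a cell" where
  "scan (c, h) = c h"

fun act :: "'a tape \<Rightarrow> 'a cell \<times> direction \<Rightarrow> 'a tape" where
  "act (c, h) (x, d) = (c(h := x), h + shift d)"

fun step :: "'a machine \<Rightarrow> 'a configuration \<Rightarrow> 'a configuration" where
  "step T (q, ts) =
     (if q \<in> {accept T, reject T} then (q, ts)
      else let (q', as) = trans T q (map scan ts) in (q', map2 act ts as))"

definition input_tape :: "'a list \<Rightarrow> 'a tape" where
  "input_tape w = ((\<lambda>i. if 0 \<le> i \<and> i < int (length w) then Inp (w ! nat i) else Blank), 0)"

definition initial :: "'a machine \<Rightarrow> 'a list \<Rightarrow> 'a configuration" where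
  "initial T w = (start T, input_tape w # replicate (tapes T - 1) (input_tape []))"

definition decides_in_time ::
    "'a set \<Rightarrow> 'a machine \<Rightarrow> 'a list set \<Rightarrow> (nat \<Rightarrow> nat) \<Rightarrow> bool" where
  "decides_in_time \<Sigma> T L t \<longleftrightarrow>
     (\<forall>w \<in> lists \<Sigma>. \<exists>k \<le> t (length w).
        fst ((step T ^^ k) (initial T w)) = (if w \<in> L then accept T else reject T))"

definition polytime_decidable :: "'a set \<Rightarrow> 'a list set \<Rightarrow> bool" where
  "polytime_decidable \<Sigma> L \<longleftrightarrow>
     finite \<Sigma> \<and> L \<subseteq> lists \<Sigma> \<and>
     (\<exists>T (p :: nat poly). is_machine \<Sigma> T \<and> decides_in_time \<Sigma> T L (poly p))"

end

theory Submission
  imports Defs "HOL-Library.Countable"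
begin

text \<open>Making every variable true at every state can only help a monotone formula, and in that
  structure the truth value of a formula does not depend on the state: \<open>F\<close>, \<open>G\<close>, \<open>X\<close> act as the
  identity and \<open>U\<close>, \<open>S\<close> return their second argument. Satisfiability is therefore the evaluation
  of a Boolean expression in prefix notation. Reading the expression from right to left, a stack
  of truth values suffices: every symbol replaces its arguments, which are then the topmost
  entries, by one value. Since the arities are bounded, a two-tape machine simulates this in
  linear time.\<close>

section \<open>Satisfiability of monotone formulae\<close>

lemma monotone_boolfunD:
  assumes "f \<in> monotone_boolfuns" "length a = fst f" "length b = fst f"
    and "\<And>i. i < fst f \<Longrightarrow> a ! i \<Longrightarrow> b ! i" and "snd f a"
  shows "snd f b"
  using assms by (cases f) (auto simp: monotone_boolfuns_def)

lemma until_mono: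
  assumes "until P Q i" "\<And>j. P j \<Longrightarrow> P' j" "\<And>k. Q k \<Longrightarrow> Q' k"
  shows "until P' Q' i"
  using assms unfolding until_def by blast

lemma since_mono:
  assumes "since P Q i" "\<And>j. P j \<Longrightarrow> P' j" "\<And>k. Q k \<Longrightarrow> Q' k"
  shows "since P' Q' i"
  using assms unfolding since_def by blast

lemma holds_mono:
  assumes "\<phi> \<in> temporal_formulas M B" "B \<subseteq> monotone_boolfuns"
    and "\<And>i. valuation S (state_at S i) \<subseteq> valuation S' (state_at S' i)"
    and "holds S i \<phi>"
  shows "holds S' i \<phi>"
  using assms(1,4)
proof (induction \<phi> arbitrary: i rule: temporal_formulas.induct)
  case (1 x)
  then show ?case using assms(3) by auto
next
  case (2 f \<phi>s)
  have "snd f (map (holds S' i) \<phi>s)"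
    by (rule monotone_boolfunD[of f "map (holds S i) \<phi>s"]) (use 2 assms(2) in auto)
  then show ?case by simp
next
  case (3 \<phi>)
  then show ?case by (auto elim: until_mono)
next
  case (4 \<phi>)
  then show ?case by (auto simp: until_def)
next
  case (6 \<phi> \<psi>)
  then show ?case by (auto elim: until_mono)
next
  case (7 \<phi> \<psi>)
  then show ?case by (auto elim: since_mono)
qed simp

definition all_true :: "nat temporal_structure" where
  "all_true = \<lparr>state_at = id, variables = UNIV, valuation = (\<lambda>_. UNIV)\<rparr>"

lemma satisfiable_iff_holds_all_true:
  assumes "\<phi> \<in> temporal_formulas M B" "B \<subseteq> monotone_boolfuns"
  shows "satisfiable \<phi> \<longleftrightarrow> (\<exists>i. holds all_true i \<phi>)"
proof
  assume "satisfiable \<phi>"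
  then obtain S :: "nat temporal_structure" and i where "holds S i \<phi>"
    by (auto simp: satisfiable_def)
  then have "holds all_true i \<phi>"
    using holds_mono[OF assms, of S all_true i] by (simp add: all_true_def)
  then show "\<exists>i. holds all_true i \<phi>" ..
next
  assume "\<exists>i. holds all_true i \<phi>"
  moreover have "is_structure all_true" by (simp add: is_structure_def all_true_def)
  ultimately show "satisfiable \<phi>" unfolding satisfiable_def by blast
qed

lemma until_const [simp]: "until (\<lambda>_. p) (\<lambda>_. q) i \<longleftrightarrow> q"
  by (auto simp: until_def)

lemma since_const [simp]: "since (\<lambda>_. p) (\<lambda>_. q) i \<longleftrightarrow> q"
  by (auto simp: since_def)

fun all_true_value :: "formula \<Rightarrow> bool" where
  "all_true_value (Var x) = True"
| "all_true_value (Conn f \<phi>s) = snd f (map all_true_value \<phi>s)"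
| "all_true_value (Future \<phi>) = all_true_value \<phi>"
| "all_true_value (Globally \<phi>) = all_true_value \<phi>"
| "all_true_value (Next \<phi>) = all_true_value \<phi>"
| "all_true_value (Until \<phi> \<psi>) = all_true_value \<psi>"
| "all_true_value (Since \<phi> \<psi>) = all_true_value \<psi>"

lemma holds_all_true: "holds all_true i \<phi> \<longleftrightarrow> all_true_value \<phi>"
proof (induction \<phi> arbitrary: i)
  case (Conn f \<phi>s)
  then have "map (holds all_true i) \<phi>s = map all_true_value \<phi>s" by simp
  then show ?case by (simp only: holds.simps all_true_value.simps)
qed (simp_all add: all_true_def)

lemma satisfiable_iff_all_true_value:
  assumes "\<phi> \<in> temporal_formulas M B" "B \<subseteq> monotone_boolfuns"
  shows "satisfiable \<phi> \<longleftrightarrow> all_true_value \<phi>"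
  using satisfiable_iff_holds_all_true[OF assms] by (simp add: holds_all_true)

section \<open>Binary notation\<close>

lemma binary_not_Nil: "binary n \<noteq> []"
  by (subst binary.simps) simp

lemma hd_binary: "n > 0 \<Longrightarrow> hd (binary n)"
proof (induction n rule: less_induct)
  case (less n)
  show ?case
  proof (cases "n < 2")
    case True
    then show ?thesis using less.prems by (subst binary.simps) simp
  next
    case False
    then have "hd (binary (n div 2))" using less.IH[of "n div 2"] by simp
    then show ?thesis using False binary_not_Nil[of "n div 2"] by (subst binary.simps) simp
  qed
qed

lemma binary_snoc: "n > 0 \<Longrightarrow> binary (2 * n + of_bool b) = binary n @ [b]"
  by (subst binary.simps) simp

lemma binary_of_bool: "binary (of_bool b) = [b]"
  by (subst binary.simps) simp

lemma ex_binary_eq_True_Cons: "\<exists>n>0. binary n = True # bs"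
proof (induction bs rule: rev_induct)
  case Nil
  show ?case using binary_of_bool[of True] by (intro exI[of _ 1]) simp
next
  case (snoc b bs)
  then obtain n where "n > 0" "binary n = True # bs" by blast
  then show ?case
    using binary_snoc[of n b] by (intro exI[of _ "2 * n + of_bool b"]) simp
qed

lemma Cons_in_range_binary: "b # bs \<in> range binary \<longleftrightarrow> bs = [] \<or> b"
proof
  assume "b # bs \<in> range binary"
  then obtain n where n: "binary n = b # bs" by (metis imageE)
  then show "bs = [] \<or> b"
    using hd_binary[of n] binary_of_bool[of False] by (cases "n = 0") auto
next
  assume "bs = [] \<or> b"
  then show "b # bs \<in> range binary"
    using binary_of_bool[of b] ex_binary_eq_True_Cons[of bs] by (metis (full_types) rangeI)
qed

section \<open>Stack machines\<close>

record ('p, 'a, 'v) stack_machine =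
  initial_mode :: 'p
  move :: "'p \<Rightarrow> 'a \<Rightarrow> 'v list \<Rightarrow> ('p \<times> 'v list) option"
  final :: "'p \<Rightarrow> 'v list \<Rightarrow> bool"

fun run :: "('p, 'a, 'v) stack_machine \<Rightarrow> 'p \<Rightarrow> 'v list \<Rightarrow> 'a list \<Rightarrow> bool" where
  "run A p vs [] \<longleftrightarrow> final A p vs"
| "run A p vs (a # w) \<longleftrightarrow> (case move A p a vs of None \<Rightarrow> False | Some (q, us) \<Rightarrow> run A q us w)"

definition right_to_left_language :: "('p, 'a, 'v) stack_machine \<Rightarrow> 'a set \<Rightarrow> 'a list set" where
  "right_to_left_language A \<Sigma> = {w \<in> lists \<Sigma>. run A (initial_mode A) [] (rev w)}"

definition determined_by_top :: "('p, 'a, 'v) stack_machine \<Rightarrow> 'a set \<Rightarrow> nat \<Rightarrow> bool" where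
  "determined_by_top A \<Sigma> N \<longleftrightarrow>
     (\<forall>p vs. final A p vs = final A p (take N vs)) \<and>
     (\<forall>a \<in> \<Sigma>. \<forall>p vs.
        move A p a vs = map_option (map_prod id (\<lambda>us. us @ drop N vs)) (move A p a (take N vs)))"

lemma determined_by_top_final: "determined_by_top A \<Sigma> N \<Longrightarrow> final A p (take N vs) = final A p vs"
  unfolding determined_by_top_def by blast

lemma determined_by_top_move:
  "determined_by_top A \<Sigma> N \<Longrightarrow> a \<in> \<Sigma> \<Longrightarrow>
    move A p a vs = map_option (map_prod id (\<lambda>us. us @ drop N vs)) (move A p a (take N vs))"
  unfolding determined_by_top_def by blast

section \<open>Evaluation of prefix notation by a stack machine\<close>

text \<open>All that must be remembered of a block of bits read so far: whether it is nonempty, and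
  if so whether it is the binary notation of a number.\<close>

definition bits_mode :: "bool list \<Rightarrow> bool option" where
  "bits_mode bs = (if bs = [] then None else Some (bs \<in> range binary))"

lemma bits_mode_Nil [simp]: "bits_mode [] = None"
  by (simp add: bits_mode_def)

lemma bits_mode_eq_None_iff [simp]: "bits_mode bs = None \<longleftrightarrow> bs = []"
  by (simp add: bits_mode_def)

lemma bits_mode_eq_Some_True_iff: "bits_mode bs = Some True \<longleftrightarrow> bs \<in> range binary"
  using binary_not_Nil[symmetric] by (auto simp: bits_mode_def)

lemma bits_mode_Cons: "bits_mode (b # bs) = Some (bits_mode bs = None \<or> b)"
  by (simp add: bits_mode_def Cons_in_range_binary)

fun arity :: "symbol \<Rightarrow> nat" where
  "arity (SConn f) = fst f"
| "arity (STemp t) = (if t \<in> {OpU, OpS} then 2 else 1)"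
| "arity _ = 0"

fun symbol_value :: "symbol \<Rightarrow> bool list \<Rightarrow> bool" where
  "symbol_value (SConn f) vs = snd f vs"
| "symbol_value (STemp t) vs = last vs"
| "symbol_value _ vs = True"

fun required_mode :: "symbol \<Rightarrow> bool option" where
  "required_mode SVar = Some True"
| "required_mode _ = None"

fun evaluator_move :: "bool option \<Rightarrow> symbol \<Rightarrow> bool list \<Rightarrow> (bool option \<times> bool list) option" where
  "evaluator_move p (SBit b) vs = Some (Some (p = None \<or> b), vs)"
| "evaluator_move p s vs =
     (if p = required_mode s \<and> arity s \<le> length vs
      then Some (None, symbol_value s (take (arity s) vs) # drop (arity s) vs) else None)"

definition evaluator :: "(bool option, symbol, bool) stack_machine" where
  "evaluator = \<lparr>
     initial_mode = None,
     move = evaluator_move,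
     final = (\<lambda>p vs. p = None \<and> vs = [True])\<rparr>"

lemma evaluator_simps [simp]:
  "initial_mode evaluator = None"
  "move evaluator = evaluator_move"
  "final evaluator p vs \<longleftrightarrow> p = None \<and> vs = [True]"
  by (simp_all add: evaluator_def)

lemma evaluator_move_not_bit:
  assumes "s \<notin> range SBit"
  shows "evaluator_move p s vs =
     (if p = required_mode s \<and> arity s \<le> length vs
      then Some (None, symbol_value s (take (arity s) vs) # drop (arity s) vs) else None)"
  using assms by (cases s) auto

lemma run_evaluator_bits:
  "run evaluator (bits_mode cs) vs (rev (map SBit bs) @ w)
    = run evaluator (bits_mode (bs @ cs)) vs w"
proof (induction bs arbitrary: cs rule: rev_induct)
  case (snoc b bs)
  show ?case using snoc[of "b # cs"] by (simp add: bits_mode_Cons)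
qed simp

lemma run_evaluator_rev_encode:
  assumes "\<phi> \<in> temporal_formulas M B"
  shows "run evaluator None vs (rev (encode \<phi>) @ w) = run evaluator None (all_true_value \<phi> # vs) w"
  using assms
proof (induction \<phi> arbitrary: vs w rule: temporal_formulas.induct)
  case (1 x)
  have "bits_mode (binary x) = Some True" by (simp add: bits_mode_eq_Some_True_iff)
  then show ?case
    using run_evaluator_bits[of "[]" vs "binary x" "SVar # w"] by simp
next
  case (2 f \<phi>s)
  have "run evaluator None vs (rev (concat (map encode \<phi>s)) @ w)
      = run evaluator None (map all_true_value \<phi>s @ vs) w" for vs w
    using "2.IH" by (induction \<phi>s arbitrary: vs w) simp_all
  then show ?case using "2.hyps" by simp
qed simp_all

lemma ex_formula_of_symbol:
  assumes "s \<in> alphabet M B" "s \<notin> range SBit"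
    and "length \<phi>s = arity s" "set \<phi>s \<subseteq> temporal_formulas M B"
    and "bits_mode bs = required_mode s"
  shows "\<exists>\<phi> \<in> temporal_formulas M B. encode \<phi> = s # map SBit bs @ concat (map encode \<phi>s) \<and>
    all_true_value \<phi> = symbol_value s (map all_true_value \<phi>s)"
proof (cases s)
  case SVar
  then obtain x where "bs = binary x"
    using assms(5) by (auto simp: bits_mode_eq_Some_True_iff)
  then show ?thesis
    using SVar assms(3) by (intro bexI[of _ "Var x"]) (auto intro: temporal_formulas.intros)
next
  case (SConn f)
  then show ?thesis
    using assms by (intro bexI[of _ "Conn f \<phi>s"]) (auto simp: alphabet_def temporal_formulas_simps)
next
  case (STemp t)
  then have t: "t \<in> M" and bs: "bs = []" using assms by (auto simp: alphabet_def)
  show ?thesis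
  proof (cases "t \<in> {OpU, OpS}")
    case True
    then obtain \<phi> \<psi> where "\<phi>s = [\<phi>, \<psi>]"
      using assms(3) STemp by (auto simp: numeral_2_eq_2 length_Suc_conv)
    then show ?thesis
      using True STemp t bs assms(4)
      by (intro bexI[of _ "if t = OpU then Until \<phi> \<psi> else Since \<phi> \<psi>"])
        (auto simp: temporal_formulas_simps)
  next
    case False
    then obtain \<phi> where "\<phi>s = [\<phi>]"
      using assms(3) STemp by (auto simp: length_Suc_conv)
    then show ?thesis
      using False STemp t bs assms(4)
      by (cases t; intro bexI[of _
            "if t = OpF then Future \<phi> else if t = OpG then Globally \<phi> else Next \<phi>"])
        (auto simp: temporal_formulas_simps)
  qed
qed (use assms(2) in blast)

lemma run_evaluator_imp_encode:
  assumes "run evaluator (bits_mode bs) (map all_true_value \<phi>s) w"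
    and "set \<phi>s \<subseteq> temporal_formulas M B" "set w \<subseteq> alphabet M B"
  shows "\<exists>\<phi> \<in> temporal_formulas M B. all_true_value \<phi> \<and>
    encode \<phi> = rev w @ map SBit bs @ concat (map encode \<phi>s)"
  using assms
proof (induction w arbitrary: bs \<phi>s)
  case Nil
  then obtain \<phi> where "\<phi>s = [\<phi>]" "all_true_value \<phi>" "bs = []" by auto
  then show ?case using Nil.prems by auto
next
  case (Cons s w)
  show ?case
  proof (cases "s \<in> range SBit")
    case True
    then obtain b where s: "s = SBit b" by blast
    then show ?thesis
      using Cons.IH[of "b # bs" \<phi>s] Cons.prems by (simp add: bits_mode_Cons)
  next
    case False
    define args where "args = take (arity s) \<phi>s"
    define rest where "rest = drop (arity s) \<phi>s"
    have split: "\<phi>s = args @ rest" by (simp add: args_def rest_def)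
    from Cons.prems(1) False have mode: "bits_mode bs = required_mode s"
      and arity: "arity s \<le> length \<phi>s"
      and run: "run evaluator None
        (symbol_value s (map all_true_value args) # map all_true_value rest) w"
      by (auto simp: evaluator_move_not_bit args_def rest_def take_map drop_map split: if_splits)
    have "length args = arity s" using arity by (simp add: args_def)
    then obtain \<phi> where \<phi>: "\<phi> \<in> temporal_formulas M B"
      "encode \<phi> = s # map SBit bs @ concat (map encode args)"
      "all_true_value \<phi> = symbol_value s (map all_true_value args)"
      using ex_formula_of_symbol[of s M B args bs] False mode Cons.prems(2,3) split by auto
    then have "\<exists>\<psi> \<in> temporal_formulas M B. all_true_value \<psi> \<and>
        encode \<psi> = rev w @ map SBit [] @ concat (map encode (\<phi> # rest))"
      using run Cons.prems(2,3) split by (intro Cons.IH) auto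
    then show ?thesis by (simp add: \<phi>(2) split)
  qed
qed

lemma encode_in_lists_alphabet:
  assumes "\<phi> \<in> temporal_formulas M B"
  shows "encode \<phi> \<in> lists (alphabet M B)"
  using assms
proof (induction rule: temporal_formulas.induct)
  case (2 f \<phi>s)
  then have "SConn f \<in> alphabet M B" by (simp add: alphabet_def)
  then show ?case using 2 by (auto simp: in_lists_conv_set)
qed (auto simp: alphabet_def)

lemma SAT_eq_right_to_left_language:
  assumes "B \<subseteq> monotone_boolfuns"
  shows "SAT M B = right_to_left_language evaluator (alphabet M B)"
proof (intro equalityI subsetI)
  fix w
  assume "w \<in> SAT M B"
  then obtain \<phi> where \<phi>: "w = encode \<phi>" "\<phi> \<in> temporal_formulas M B" "all_true_value \<phi>"
    using satisfiable_iff_all_true_value[OF _ assms] by (auto simp: SAT_def)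
  then have "run evaluator None [] (rev w)"
    using run_evaluator_rev_encode[OF \<phi>(2), of "[]" "[]"] by simp
  then show "w \<in> right_to_left_language evaluator (alphabet M B)"
    using \<phi> encode_in_lists_alphabet by (simp add: right_to_left_language_def)
next
  fix w
  assume "w \<in> right_to_left_language evaluator (alphabet M B)"
  then have "run evaluator None [] (rev w)" "set (rev w) \<subseteq> alphabet M B"
    by (auto simp: right_to_left_language_def)
  then obtain \<phi> where "\<phi> \<in> temporal_formulas M B" "all_true_value \<phi>" "encode \<phi> = w"
    using run_evaluator_imp_encode[of "[]" "[]" "rev w" M B] by auto
  then show "w \<in> SAT M B"
    using satisfiable_iff_all_true_value[OF _ assms] by (auto simp: SAT_def)
qed

lemma evaluator_move_append:
  assumes "arity s \<le> length vs \<or> us = []"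
  shows "evaluator_move p s (vs @ us)
    = map_option (map_prod id (\<lambda>ws. ws @ us)) (evaluator_move p s vs)"
  using assms by (cases s) auto

text \<open>Depth 2 is needed to tell the accepting stack from a larger one.\<close>

lemma determined_by_top_evaluator:
  assumes "2 \<le> N" "\<And>s. s \<in> \<Sigma> \<Longrightarrow> arity s \<le> N"
  shows "determined_by_top evaluator \<Sigma> N"
proof -
  have "vs = [True] \<longleftrightarrow> take N vs = [True]" for vs
    using assms(1) by (cases "length vs \<le> N") (auto dest: arg_cong[of _ _ length])
  moreover have "evaluator_move p s vs
      = map_option (map_prod id (\<lambda>us. us @ drop N vs)) (evaluator_move p s (take N vs))"
    if "s \<in> \<Sigma>" for p s vs
  proof -
    have "arity s \<le> length (take N vs) \<or> drop N vs = []" using assms(2)[OF that] by auto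
    from evaluator_move_append[OF this, of p] show ?thesis by (simp only: append_take_drop_id)
  qed
  ultimately show ?thesis unfolding determined_by_top_def evaluator_simps by blast
qed

section \<open>Running times and tapes of machines\<close>

definition answers_within :: "'a machine \<Rightarrow> nat \<Rightarrow> 'a configuration \<Rightarrow> bool \<Rightarrow> bool" where
  "answers_within T k conf b \<longleftrightarrow>
     (\<exists>j\<le>k. fst ((step T ^^ j) conf) = (if b then accept T else reject T))"

lemma answers_within_now:
  "fst conf = (if b then accept T else reject T) \<Longrightarrow> answers_within T k conf b"
  unfolding answers_within_def by (intro exI[of _ 0]) simp

lemma answers_within_Suc: "answers_within T k (step T conf) b \<Longrightarrow> answers_within T (Suc k) conf b"
  unfolding answers_within_def by (metis Suc_le_mono comp_apply funpow_Suc_right)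

lemma answers_within_mono: "answers_within T k conf b \<Longrightarrow> k \<le> l \<Longrightarrow> answers_within T l conf b"
  unfolding answers_within_def using le_trans by blast

lemma decides_in_time_iff_answers_within:
  "decides_in_time \<Sigma> T L t \<longleftrightarrow>
     (\<forall>w \<in> lists \<Sigma>. answers_within T (t (length w)) (initial T w) (w \<in> L))"
  by (simp add: decides_in_time_def answers_within_def)

definition go :: "direction \<Rightarrow> 'a tape \<Rightarrow> 'a tape" where
  "go d t = (fst t, snd t + shift d)"

lemma go_Pair [simp]: "go d (c, h) = (c, h + shift d)"
  by (simp add: go_def)

lemma go_Stay [simp]: "go Stay t = t"
  by (cases t) simp

lemma act_scan: "scan t = x \<Longrightarrow> act t (x, d) = go d t"
  by (cases t) auto

lemma go_left_go_right [simp]: "go MoveLeft (go MoveRight t) = t"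
  by (cases t) simp

fun reads_left :: "'a cell list \<Rightarrow> 'a tape \<Rightarrow> bool" where
  "reads_left [] t \<longleftrightarrow> scan t = Blank"
| "reads_left (x # xs) t \<longleftrightarrow> scan t = x \<and> reads_left xs (go MoveLeft t)"

lemma reads_left_upd_right: "h < k \<Longrightarrow> reads_left xs (c(k := y), h) = reads_left xs (c, h)"
  by (induction xs arbitrary: h) auto

lemma reads_left_write_right:
  assumes "reads_left xs (go MoveLeft t)"
  shows "reads_left (x # xs) (go MoveLeft (act t (x, MoveRight)))"
  using assms by (cases t) (simp add: reads_left_upd_right)

lemma reads_left_input_tape_take:
  "n \<le> length w \<Longrightarrow> reads_left (map Inp (rev (take n w))) (fst (input_tape w), int n - 1)"
  by (induction n) (auto simp: input_tape_def take_Suc_conv_app_nth)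

section \<open>Simulation of stack machines by Turing machines\<close>

text \<open>The input tape is read only. The stack is written to the left of the head of the second
  tape: \<open>Pop p vs\<close> has its topmost entry under the head and has already popped \<open>vs\<close>, whereas
  \<open>Push q us\<close> has the head on the free cell above the stack and has still to push \<open>us\<close>.\<close>

datatype ('p, 'v) control = Seek | Pop 'p "'v list" | Push 'p "'v list" | Accept | Reject

instance control :: (countable, countable) countable
  by countable_datatype

definition verdict :: "bool \<Rightarrow> ('p, 'v) control" where
  "verdict b = (if b then Accept else Reject)"

definition stack_cell :: "'v::countable \<Rightarrow> 'a cell" where
  "stack_cell v = Aux (to_nat v)"

definition stack_entry :: "'a cell \<Rightarrow> 'v::countable" where
  "stack_entry b = (case b of Aux i \<Rightarrow> from_nat i | _ \<Rightarrow> undefined)"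

lemma stack_entry_stack_cell [simp]: "stack_entry (stack_cell v) = v"
  by (simp add: stack_entry_def stack_cell_def)

lemma stack_cell_not_Blank [simp]: "stack_cell v \<noteq> Blank"
  by (simp add: stack_cell_def)

lemma finite_lists_bounded_length: "finite {xs :: 'a::finite list. length xs \<le> n}"
  using finite_lists_length_le[of "UNIV :: 'a set" n] by simp

locale stack_machine_simulation =
  fixes A :: "('p::finite, 'a, 'v::finite) stack_machine" and \<Sigma> :: "'a set" and N K :: nat
  assumes finite_alphabet: "finite \<Sigma>"
    and determined_by_top: "determined_by_top A \<Sigma> N"
    and bounded_push: "\<lbrakk>a \<in> \<Sigma>; length vs \<le> N; move A p a vs = Some (q, us)\<rbrakk> \<Longrightarrow> length us \<le> K"
begin

fun respond :: "'p \<Rightarrow> 'v list \<Rightarrow> 'a cell \<Rightarrow> ('p, 'v) control" where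
  "respond p vs (Inp a) = (case move A p a vs of None \<Rightarrow> Reject | Some (q, us) \<Rightarrow> Push q (rev us))"
| "respond p vs _ = verdict (final A p vs)"

fun control_step ::
    "('p, 'v) control \<Rightarrow> 'a cell \<Rightarrow> 'a cell \<Rightarrow>
      ('p, 'v) control \<times> direction \<times> 'a cell \<times> direction" where
  "control_step Seek a b =
     (if a = Blank then (Pop (initial_mode A) [], MoveLeft, b, Stay)
      else (Seek, MoveRight, b, Stay))"
| "control_step (Pop p vs) a b =
     (if length vs < N \<and> b \<noteq> Blank then (Pop p (vs @ [stack_entry b]), Stay, b, MoveLeft)
      else (respond p vs a, Stay, b, MoveRight))"
| "control_step (Push q (u # us)) a b = (Push q us, Stay, stack_cell u, MoveRight)"
| "control_step (Push q []) a b = (Pop q [], MoveLeft, b, MoveLeft)"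
| "control_step c a b = (c, Stay, b, Stay)"

definition controls :: "('p, 'v) control set" where
  "controls = {Seek, Accept, Reject} \<union> {Pop p vs | p vs. length vs \<le> N}
     \<union> {Push q us | q us. length us \<le> K}"

definition simulator :: "'a machine" where
  "simulator = \<lparr>
     tapes = 2,
     states = to_nat ` controls,
     tape_alphabet = {Blank} \<union> Inp ` \<Sigma> \<union> range (stack_cell :: 'v \<Rightarrow> 'a cell),
     start = to_nat (Seek :: ('p, 'v) control),
     accept = to_nat (Accept :: ('p, 'v) control),
     reject = to_nat (Reject :: ('p, 'v) control),
     trans = (\<lambda>q xs. case control_step (from_nat q) (xs ! 0) (xs ! 1) of
       (c, d, y, e) \<Rightarrow> (to_nat c, [(xs ! 0, d), (y, e)]))\<rparr>"

lemma finite_controls: "finite controls"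
proof -
  have "controls = {Seek, Accept, Reject} \<union> (\<lambda>(p, vs). Pop p vs) ` (UNIV \<times> {vs. length vs \<le> N})
      \<union> (\<lambda>(q, us). Push q us) ` (UNIV \<times> {us. length us \<le> K})"
    by (auto simp: controls_def)
  then show ?thesis by (simp add: finite_lists_bounded_length)
qed

lemma respond_in_controls:
  assumes "length vs \<le> N" "a \<in> tape_alphabet simulator"
  shows "respond p vs a \<in> controls"
proof (cases "\<exists>s. a = Inp s")
  case True
  then obtain s where "a = Inp s" "s \<in> \<Sigma>"
    using assms(2) by (auto simp: simulator_def stack_cell_def)
  then show ?thesis
    using bounded_push[OF _ assms(1)] by (auto simp: controls_def split: option.split)
next
  case False
  then show ?thesis by (cases a) (auto simp: controls_def verdict_def)
qed

lemma control_step_closed: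
  assumes "c \<in> controls" "a \<in> tape_alphabet simulator" "b \<in> tape_alphabet simulator"
    and "control_step c a b = (c', d, y, e)"
  shows "c' \<in> controls \<and> y \<in> tape_alphabet simulator"
proof (cases c)
  case (Pop p vs)
  then have "length vs \<le> N" using assms(1) by (auto simp: controls_def)
  then show ?thesis
    using Pop assms respond_in_controls[of vs a p] by (auto simp: controls_def split: if_splits)
next
  case (Push q us)
  then show ?thesis using assms by (cases us) (auto simp: controls_def simulator_def)
qed (use assms in \<open>auto simp: controls_def split: if_splits\<close>)

lemma trans_simulator_closed:
  assumes "q \<in> to_nat ` controls" "xs \<in> lists (tape_alphabet simulator)" "length xs = 2"
  shows "fst (trans simulator q xs) \<in> to_nat ` controls"
    and "length (snd (trans simulator q xs)) = 2"
    and "snd (trans simulator q xs) \<in> lists (tape_alphabet simulator \<times> UNIV)"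
proof -
  obtain c where c: "c \<in> controls" "q = to_nat c" using assms(1) by blast
  obtain a b where ab: "xs = [a, b]" "a \<in> tape_alphabet simulator" "b \<in> tape_alphabet simulator"
    using assms(2,3) by (auto simp: numeral_2_eq_2 length_Suc_conv)
  obtain c' d y e where st: "control_step c a b = (c', d, y, e)" by (cases "control_step c a b")
  then have closed: "c' \<in> controls" "y \<in> tape_alphabet simulator"
    using control_step_closed[OF c(1) ab(2,3)] by blast+
  have "trans simulator q xs = (to_nat c', [(a, d), (y, e)])"
    using st c ab(1) by (simp add: simulator_def)
  then show "fst (trans simulator q xs) \<in> to_nat ` controls"
    "length (snd (trans simulator q xs)) = 2"
    "snd (trans simulator q xs) \<in> lists (tape_alphabet simulator \<times> UNIV)"
    using closed ab(2) by simp_all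
qed

lemma is_machine_simulator: "is_machine \<Sigma> simulator"
proof -
  have "finite (tape_alphabet simulator)" using finite_alphabet by (simp add: simulator_def)
  moreover have "states simulator = to_nat ` controls" "tapes simulator = 2"
    by (simp_all add: simulator_def)
  moreover have "{start simulator, accept simulator, reject simulator} \<subseteq> to_nat ` controls"
    "accept simulator \<noteq> reject simulator" "insert Blank (Inp ` \<Sigma>) \<subseteq> tape_alphabet simulator"
    by (auto simp: simulator_def controls_def)
  ultimately show ?thesis
    unfolding is_machine_def using finite_controls trans_simulator_closed by simp
qed

definition config :: "('p, 'v) control \<Rightarrow> 'a tape \<Rightarrow> 'a tape \<Rightarrow> 'a configuration" where
  "config c t s = (to_nat c, [t, s])"

lemma step_config:
  "scan t \<noteq> Blank \<Longrightarrow> step simulator (config Seek t s) = config Seek (go MoveRight t) s"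
  "scan t = Blank \<Longrightarrow>
    step simulator (config Seek t s) = config (Pop (initial_mode A) []) (go MoveLeft t) s"
  "length us < N \<Longrightarrow> scan s = stack_cell v \<Longrightarrow>
    step simulator (config (Pop p us) t s) = config (Pop p (us @ [v])) t (go MoveLeft s)"
  "length us \<ge> N \<or> scan s = Blank \<Longrightarrow>
    step simulator (config (Pop p us) t s) = config (respond p us (scan t)) t (go MoveRight s)"
  "step simulator (config (Push q (u # us)) t s)
    = config (Push q us) t (act s (stack_cell u, MoveRight))"
  "step simulator (config (Push q []) t s) = config (Pop q []) (go MoveLeft t) (go MoveLeft s)"
  by (auto simp: config_def simulator_def act_scan)

lemma answers_within_verdict: "answers_within simulator k (config (verdict b) t s) b"
  by (rule answers_within_now) (simp add: config_def verdict_def simulator_def)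

lemma answers_within_Pop:
  assumes "reads_left (map stack_cell vs) s"
    and "\<And>s'. reads_left (map stack_cell (drop (N - length us) vs)) s' \<Longrightarrow> answers_within simulator k
      (config (respond p (us @ take (N - length us) vs) (scan t)) t (go MoveRight s')) r"
  shows "answers_within simulator (N - length us + Suc k) (config (Pop p us) t s) r"
  using assms
proof (induction vs arbitrary: us s)
  case Nil
  then have "answers_within simulator (Suc k) (config (Pop p us) t s) r"
    by (intro answers_within_Suc) (simp add: step_config)
  then show ?case by (rule answers_within_mono) simp
next
  case (Cons v vs)
  have top: "scan s = stack_cell v" and below: "reads_left (map stack_cell vs) (go MoveLeft s)"
    using Cons.prems(1) by simp_all
  show ?case
  proof (cases "length us < N")
    case True
    then have count: "N - length us = Suc (N - length (us @ [v]))" by simp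
    have "answers_within simulator (N - length (us @ [v]) + Suc k)
        (config (Pop p (us @ [v])) t (go MoveLeft s)) r"
      using below Cons.prems(2) unfolding count by (intro Cons.IH) simp_all
    then show ?thesis
      unfolding count add_Suc using True top by (intro answers_within_Suc) (simp add: step_config)
  next
    case False
    then have "answers_within simulator (Suc k) (config (Pop p us) t s) r"
      using Cons.prems by (intro answers_within_Suc) (simp add: step_config)
    then show ?thesis using False by simp
  qed
qed

lemma answers_within_Push:
  assumes "reads_left (map stack_cell vs) (go MoveLeft s)"
    and "\<And>s'. reads_left (map stack_cell (rev us @ vs)) s' \<Longrightarrow>
      answers_within simulator k (config (Pop q []) (go MoveLeft t) s') r"
  shows "answers_within simulator (length us + Suc k) (config (Push q us) t s) r"
  using assms
proof (induction us arbitrary: vs s)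
  case Nil
  then have "answers_within simulator (Suc k) (config (Push q []) t s) r"
    by (intro answers_within_Suc) (simp add: step_config)
  then show ?case by simp
next
  case (Cons u us)
  have "answers_within simulator (length us + Suc k)
      (config (Push q us) t (act s (stack_cell u, MoveRight))) r"
  proof (rule Cons.IH)
    show "reads_left (map stack_cell (u # vs)) (go MoveLeft (act s (stack_cell u, MoveRight)))"
      using reads_left_write_right[OF Cons.prems(1)] by simp
  qed (use Cons.prems(2) in simp)
  then have "answers_within simulator (Suc (length us + Suc k)) (config (Push q (u # us)) t s) r"
    by (intro answers_within_Suc) (simp add: step_config)
  then show ?case by simp
qed

lemma answers_within_letter:
  assumes "a \<in> \<Sigma>" "scan t = Inp a" "reads_left (map stack_cell vs) s"
    and "move A p a vs = None \<Longrightarrow> \<not> r"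
    and "\<And>q us s'. move A p a vs = Some (q, us) \<Longrightarrow> reads_left (map stack_cell us) s' \<Longrightarrow>
      answers_within simulator k (config (Pop q []) (go MoveLeft t) s') r"
  shows "answers_within simulator (N + K + 2 + k) (config (Pop p []) t s) r"
proof -
  note move = determined_by_top_move[OF determined_by_top assms(1), of p vs]
  have "answers_within simulator (K + Suc k)
      (config (respond p (take N vs) (scan t)) t (go MoveRight s')) r"
    if s': "reads_left (map stack_cell (drop N vs)) s'" for s'
  proof (cases "move A p a (take N vs)")
    case None
    then have "\<not> r" using assms(4) move by simp
    then show ?thesis
      using None assms(2) answers_within_verdict[of _ False] by (simp add: verdict_def)
  next
    case (Some qus)
    then obtain q us where us: "move A p a (take N vs) = Some (q, us)" by (cases qus) simp
    have "answers_within simulator (length (rev us) + Suc k)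
        (config (Push q (rev us)) t (go MoveRight s')) r"
    proof (rule answers_within_Push)
      show "reads_left (map stack_cell (drop N vs)) (go MoveLeft (go MoveRight s'))"
        using s' by simp
      show "answers_within simulator k (config (Pop q []) (go MoveLeft t) s'') r"
        if "reads_left (map stack_cell (rev (rev us) @ drop N vs)) s''" for s''
        using that us move by (intro assms(5)[of q "us @ drop N vs"]) simp_all
    qed
    moreover have "length us \<le> K" using bounded_push[OF assms(1) _ us] by simp
    ultimately show ?thesis using assms(2) us by (auto elim: answers_within_mono)
  qed
  then have "answers_within simulator (N + Suc (K + Suc k)) (config (Pop p []) t s) r"
    using answers_within_Pop[OF assms(3), of "[]" "K + Suc k" p t] by simp
  then show ?thesis by (simp add: add.assoc)
qed

lemma answers_within_run:
  assumes "set w \<subseteq> \<Sigma>" "reads_left (map Inp w) t" "reads_left (map stack_cell vs) s"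
  shows "answers_within simulator ((N + K + 2) * length w + N + 1) (config (Pop p []) t s)
    (run A p vs w)"
  using assms
proof (induction w arbitrary: p vs t s)
  case Nil
  have "respond p (take N vs) (scan t) = verdict (run A p vs [])"
    using Nil.prems(2) by (simp add: determined_by_top_final[OF determined_by_top])
  then show ?case
    using answers_within_Pop[OF Nil.prems(3), of "[]" 0] by (simp add: answers_within_verdict)
next
  case (Cons a w)
  let ?k = "(N + K + 2) * length w + N + 1"
  have "answers_within simulator (N + K + 2 + ?k) (config (Pop p []) t s) (run A p vs (a # w))"
  proof (rule answers_within_letter)
    show "a \<in> \<Sigma>" "scan t = Inp a" "reads_left (map stack_cell vs) s"
      using Cons.prems by simp_all
    show "answers_within simulator ?k (config (Pop q []) (go MoveLeft t) s') (run A p vs (a # w))"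
      if "move A p a vs = Some (q, us)" "reads_left (map stack_cell us) s'" for q us s'
      using Cons.IH[of "go MoveLeft t" us s' q] Cons.prems that by simp
  qed simp
  then show ?case by (simp add: algebra_simps)
qed

lemma answers_within_Seek:
  assumes "n \<le> length w"
    and "answers_within simulator k
      (config (Pop (initial_mode A) []) (fst (input_tape w), int (length w) - 1) s) r"
  shows "answers_within simulator (n + Suc k)
    (config Seek (fst (input_tape w), int (length w - n)) s) r"
  using assms(1)
proof (induction n)
  case 0
  have "scan (fst (input_tape w), int (length w)) = Blank" by (simp add: input_tape_def)
  then have "answers_within simulator (Suc k)
      (config Seek (fst (input_tape w), int (length w)) s) r"
    using assms(2) by (intro answers_within_Suc) (simp add: step_config)
  then show ?case by simp
next
  case (Suc n)
  let ?t = "(fst (input_tape w), int (length w - Suc n))"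
  have "scan ?t \<noteq> Blank" using Suc.prems by (simp add: input_tape_def)
  moreover have "go MoveRight ?t = (fst (input_tape w), int (length w - n))"
    using Suc.prems by simp
  ultimately have "answers_within simulator (Suc (n + Suc k)) (config Seek ?t s) r"
    using Suc by (intro answers_within_Suc) (simp add: step_config)
  then show ?case by simp
qed

lemma simulator_decides:
  "decides_in_time \<Sigma> simulator (right_to_left_language A \<Sigma>) (poly [:N + 2, N + K + 3:])"
  unfolding decides_in_time_iff_answers_within
proof
  fix w
  assume w: "w \<in> lists \<Sigma>"
  let ?k = "(N + K + 2) * length w + N + 1"
  let ?t = "(fst (input_tape w), int (length w) - 1)"
  have "reads_left (map Inp (rev w)) ?t"
    using reads_left_input_tape_take[of "length w" w] by simp
  moreover have "reads_left (map stack_cell []) (input_tape [])" by (simp add: input_tape_def)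
  ultimately have "answers_within simulator ?k (config (Pop (initial_mode A) []) ?t (input_tape []))
      (w \<in> right_to_left_language A \<Sigma>)"
    using answers_within_run[of "rev w" ?t "[]" "input_tape []" "initial_mode A"] w
    by (simp add: right_to_left_language_def subset_iff in_lists_conv_set)
  then have "answers_within simulator (length w + Suc ?k)
      (config Seek (fst (input_tape w), 0) (input_tape [])) (w \<in> right_to_left_language A \<Sigma>)"
    using answers_within_Seek[OF order.refl] by (metis diff_self_eq_0 of_nat_0)
  moreover have "config Seek (fst (input_tape w), 0) (input_tape []) = initial simulator w"
    by (simp add: config_def initial_def simulator_def input_tape_def)
  moreover have "length w + Suc ?k = poly [:N + 2, N + K + 3:] (length w)"
    by (simp add: algebra_simps)
  ultimately show "answers_within simulator (poly [:N + 2, N + K + 3:] (length w))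
      (initial simulator w) (w \<in> right_to_left_language A \<Sigma>)"
    by (simp only:)
qed

end

theorem polytime_decidable_right_to_left_language:
  fixes A :: "('p::finite, 'a, 'v::finite) stack_machine"
  assumes "finite \<Sigma>" "determined_by_top A \<Sigma> N"
  shows "polytime_decidable \<Sigma> (right_to_left_language A \<Sigma>)"
proof -
  let ?pushed = "\<lambda>(p, a, vs). length (snd (the (move A p a vs)))"
  let ?moves = "UNIV \<times> \<Sigma> \<times> {vs. length vs \<le> N}"
  have "finite (?pushed ` ?moves)" using assms(1) by (simp add: finite_lists_bounded_length)
  then obtain K where K: "?pushed x \<le> K" if "x \<in> ?moves" for x
    unfolding finite_nat_set_iff_bounded_le by blast
  interpret stack_machine_simulation A \<Sigma> N K
  proof
    show "length us \<le> K" if "a \<in> \<Sigma>" "length vs \<le> N" "move A p a vs = Some (q, us)" for a vs p q us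
      using K[of "(p, a, vs)"] that by simp
  qed (fact assms)+
  show ?thesis
    unfolding polytime_decidable_def
    using assms(1) is_machine_simulator simulator_decides
    by (auto simp: right_to_left_language_def)
qed

theorem theorem3p7:
  fixes B :: "boolfun set"
  assumes "finite B" and "B \<subseteq> monotone_boolfuns"
  shows "polytime_decidable (alphabet {OpF, OpG, OpX, OpU, OpS} B) (SAT {OpF, OpG, OpX, OpU, OpS} B)"
proof -
  let ?\<Sigma> = "alphabet {OpF, OpG, OpX, OpU, OpS} B"
  have fin: "finite ?\<Sigma>" using assms(1) by (simp add: alphabet_def)
  then obtain N where "\<forall>s \<in> ?\<Sigma>. arity s \<le> N"
    using finite_nat_set_iff_bounded_le[of "arity ` ?\<Sigma>"] by auto
  then have "determined_by_top evaluator ?\<Sigma> (max 2 N)"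
    by (intro determined_by_top_evaluator) (auto simp: le_max_iff_disj)
  with fin have "polytime_decidable ?\<Sigma> (right_to_left_language evaluator ?\<Sigma>)"
    by (rule polytime_decidable_right_to_left_language)
  then show ?thesis by (simp only: SAT_eq_right_to_left_language[OF assms(2)])
qed

end
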